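(* Let $\mathbb{F}$ be a field and let $n\ge 2$ be an integer. Let $\Gamma$ be the singular difference graph of $M_n(\mathbb{F})$. Then $\Gamma$ is connected and $\operatorname{diam}(\Gamma)=2$.
   Context: $M_n(\mathbb{F})$ is the vector space of all $n\times n$ matrices over $\mathbb{F}$. The singular difference graph $\Gamma$ of $M_n(\mathbb{F})$ is the simple (possibly infinite) graph with vertex set $M_n(\mathbb{F})$ in which two distinct matrices $A,B$ are adjacent if and only if $\det(A-B)=0$. A graph is connected if any two vertices are joined by a (finite) path. The distance between two vertices is the length (number of edges) of a shortest path joining them, and $\operatorname{diam}(\Gamma)$ is the maximum distance between any two vertices of $\Gamma$. *)

theory Defs
  imports
    "Jordan_Normal_Form.Determinant"
    "Graph_Theory.Digraph_Component"
    "HOL-Library.Extended_Nat"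
begin

text \<open>
  As usual in \<^theory>\<open>Graph_Theory.Pair_Digraph\<close>, the undirected simple graph is represented by
  a symmetric, loop-free set of arcs: an edge \<open>AB\<close> is the pair of arcs \<open>(A, B)\<close> and \<open>(B, A)\<close>
  (see \<open>singular_difference_graph_simple\<close> below).
\<close>

definition singular_difference_graph ::
    "nat \<Rightarrow> ('a::field mat, 'a mat \<times> 'a mat) pre_digraph" where
  "singular_difference_graph n = with_proj
     \<lparr> pverts = carrier_mat n n,
       parcs = {(A, B). A \<in> carrier_mat n n \<and> B \<in> carrier_mat n n \<and> A \<noteq> B \<and> det (A - B) = 0} \<rparr>"

text \<open>
  The infimum over the empty set is \<open>\<infinity>\<close>, the distance of vertices joined by no path.
  Nonempty infima, and finite suprema of nonempty sets, are attained in \<^typ>\<open>enat\<close>, so they are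
  the minimum (shortest path) and the maximum.
\<close>

definition graph_dist :: "('v, 'e) pre_digraph \<Rightarrow> 'v \<Rightarrow> 'v \<Rightarrow> enat" where
  "graph_dist G u v = (INF p \<in> {p. pre_digraph.apath G u p v}. enat (length p))"

definition graph_diam :: "('v, 'e) pre_digraph \<Rightarrow> enat" where
  "graph_diam G = (SUP u \<in> verts G. SUP v \<in> verts G. graph_dist G u v)"

lemma singular_difference_graph_simple:
  fixes n :: nat and \<Gamma> :: "('a::field mat, 'a mat \<times> 'a mat) pre_digraph"
  defines "\<Gamma> \<equiv> singular_difference_graph n"
  shows "loopfree_digraph \<Gamma>" "symmetric \<Gamma>"
proof -
  show "loopfree_digraph \<Gamma>"
    unfolding \<Gamma>_def
    by unfold_locales (auto simp: singular_difference_graph_def)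
next
  have "det (B - A) = 0"
    if "A \<in> carrier_mat n n" "B \<in> carrier_mat n n" "det (A - B) = 0" for A B :: "'a mat"
  proof -
    have "B - A = (- 1) \<cdot>\<^sub>m (A - B)"
      using that(1,2) by (intro eq_matI) auto
    then show ?thesis
      using that(3) by simp
  qed
  then show "symmetric \<Gamma>"
    by (auto simp: \<Gamma>_def symmetric_def singular_difference_graph_def sym_def)
qed

end

theory Submission
  imports Defs
begin

text \<open>
  A matrix with a zero row is singular, so two matrices that agree in one row are equal or
  adjacent. If \<open>n \<ge> 2\<close>, then any two matrices \<open>A\<close> and \<open>B\<close> have a common neighbour or are
  themselves equal or adjacent: the matrix \<open>C\<close> whose row \<open>0\<close> is that of \<open>A\<close> and whose other rows
  are those of \<open>B\<close> agrees with \<open>A\<close> in row \<open>0\<close> and with \<open>B\<close> in row \<open>1\<close>. This gives a path of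
  length at most \<open>2\<close> between any two vertices
  (\<open>singular_difference_graph_short_path\<close>), hence connectedness and the upper bound. The bound is
  attained because the zero matrix and the identity matrix are distinct and not adjacent: their
  difference is invertible.
\<close>

lemma graph_dist_le:
  assumes "pre_digraph.apath G u p v"
  shows "graph_dist G u v \<le> enat (length p)"
  using assms by (auto simp: graph_dist_def intro: INF_lower)

lemma (in wf_digraph) two_le_graph_dist:
  assumes "u \<noteq> v" and "(u, v) \<notin> arcs_ends G"
  shows "2 \<le> graph_dist G u v"
proof -
  have "2 \<le> length p" if "apath u p v" for p
  proof (rule ccontr)
    assume "\<not> 2 \<le> length p"
    then consider "p = []" | e where "p = [e]"
      by (cases p; cases "tl p") auto
    then show False
      using that assms by cases (auto simp: apath_simps arcs_ends_conv)
  qed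
  then show ?thesis
    by (auto simp: graph_dist_def le_INF_iff numeral_eq_enat)
qed

lemma (in wf_digraph) connected_if_reachable:
  assumes "verts G \<noteq> {}" and "\<And>u v. u \<in> verts G \<Longrightarrow> v \<in> verts G \<Longrightarrow> u \<rightarrow>\<^sup>* v"
  shows "Digraph_Component.connected G"
  using assms
  by (auto simp: Digraph_Component.connected_def strongly_connected_def
      intro: reachable_mk_symmetricI)

lemma det_diff_common_row:
  fixes A B :: "'a::comm_ring_1 mat"
  assumes A: "A \<in> carrier_mat n n" and B: "B \<in> carrier_mat n n"
    and k: "k < n" and row: "row A k = row B k"
  shows "det (A - B) = 0"
proof -
  have "row (A - B) k = 0\<^sub>v n"
  proof (rule eq_vecI)
    fix j assume "j < dim_vec (0\<^sub>v n :: 'a vec)"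
    moreover from this have "A $$ (k, j) = B $$ (k, j)"
      using arg_cong[OF row, of "\<lambda>v. v $ j"] A B k by simp
    ultimately show "row (A - B) k $ j = 0\<^sub>v n $ j"
      using A B k by simp
  qed (use B in simp)
  then have "A - B = mat\<^sub>r n n (\<lambda>i. if i = k then 0\<^sub>v n else row (A - B) i)"
    using A B by (intro eq_rowI) auto
  moreover have "row (A - B) \<in> {0..<n} \<rightarrow> carrier_vec n"
    using row_carrier[of "A - B"] B by auto
  ultimately show ?thesis
    using det_row_0[OF k] by metis
qed

lemma singular_difference_graph_simps [simp]:
  "verts (singular_difference_graph n) = carrier_mat n n"
  "tail (singular_difference_graph n) = fst"
  "head (singular_difference_graph n) = snd"
  "(A, B) \<in> arcs (singular_difference_graph n) \<longleftrightarrow>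
    A \<in> carrier_mat n n \<and> B \<in> carrier_mat n n \<and> A \<noteq> B \<and> det (A - B) = 0"
  by (simp_all add: singular_difference_graph_def)

lemma wf_digraph_singular_difference_graph: "wf_digraph (singular_difference_graph n)"
  using singular_difference_graph_simple(1) by (rule loopfree_digraph.axioms(1))

lemma singular_difference_graph_short_path:
  fixes A B :: "'a::field mat"
  assumes n: "n \<ge> 2" and A: "A \<in> carrier_mat n n" and B: "B \<in> carrier_mat n n"
  obtains p where "pre_digraph.apath (singular_difference_graph n) A p B" and "length p \<le> 2"
proof -
  interpret wf_digraph "singular_difference_graph n :: ('a mat, _) pre_digraph"
    by (rule wf_digraph_singular_difference_graph)
  define C where "C = mat\<^sub>r n n (\<lambda>i. if i = 0 then row A i else row B i)"
  have C: "C \<in> carrier_mat n n"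
    by (simp add: C_def)
  have "row C 0 = row A 0" and "row C 1 = row B 1"
    using n A B by (simp_all add: C_def)
  then have AC: "det (A - C) = 0" and CB: "det (C - B) = 0"
    using n by (auto intro: det_diff_common_row[OF A C, of 0] det_diff_common_row[OF C B, of 1])
  (* The detour through C is taken only when A and B are neither equal nor adjacent; then C
     differs from both, since otherwise one of the two vanishing determinants would be det (A - B). *)
  consider "A = B" | "A \<noteq> B" "det (A - B) = 0" | "A \<noteq> B" "A \<noteq> C" "C \<noteq> B"
    using AC CB by blast
  then show thesis
  proof cases
    case 1
    with B have "apath A [] B"
      by (simp add: apath_Nil_iff)
    then show thesis
      using that by simp
  next
    case 2
    with A B have "apath A [(A, B)] B"
      by (simp add: apath_Nil_iff apath_Cons_iff)
    then show thesis
      using that by simp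
  next
    case 3
    with A B C AC CB have "apath A [(A, C), (C, B)] B"
      by (simp add: apath_Nil_iff apath_Cons_iff)
    then show thesis
      using that by simp
  qed
qed

lemma zero_one_not_adjacent:
  "(0\<^sub>m n n, 1\<^sub>m n) \<notin> arcs_ends (singular_difference_graph n :: ('a::field mat, _) pre_digraph)"
proof -
  have "0\<^sub>m n n - 1\<^sub>m n = (- 1 :: 'a) \<cdot>\<^sub>m 1\<^sub>m n"
    by (intro eq_matI) auto
  then show ?thesis
    by (simp add: singular_difference_graph_def)
qed

theorem theorem4p2:
  fixes n :: nat
    and \<Gamma> :: "('a::field mat, 'a mat \<times> 'a mat) pre_digraph"
  assumes "n \<ge> 2"
    and "\<Gamma> = singular_difference_graph n"
  shows "Digraph_Component.connected \<Gamma> \<and> graph_diam \<Gamma> = 2"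
proof
  interpret wf_digraph \<Gamma>
    unfolding assms(2) by (rule wf_digraph_singular_difference_graph)
  have verts: "verts \<Gamma> = carrier_mat n n"
    by (simp add: assms(2))
  have short: "\<exists>p. apath A p B \<and> length p \<le> 2" if "A \<in> verts \<Gamma>" "B \<in> verts \<Gamma>" for A B
  proof -
    have "A \<in> carrier_mat n n" and "B \<in> carrier_mat n n"
      using that by (simp_all add: verts)
    then show ?thesis
      unfolding assms(2) using singular_difference_graph_short_path[OF assms(1)] by metis
  qed
  show "Digraph_Component.connected \<Gamma>"
  proof (rule connected_if_reachable)
    show "verts \<Gamma> \<noteq> {}"
      unfolding verts using zero_carrier_mat by blast
    show "A \<rightarrow>\<^sup>*\<^bsub>\<Gamma>\<^esub> B" if "A \<in> verts \<Gamma>" "B \<in> verts \<Gamma>" for A B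
      using short[OF that] by (auto intro: reachable_awalkI dest: awalkI_apath)
  qed
  show "graph_diam \<Gamma> = 2"
  proof (rule antisym)
    have "graph_dist \<Gamma> A B \<le> 2" if AB: "A \<in> verts \<Gamma>" "B \<in> verts \<Gamma>" for A B
    proof -
      obtain p where p: "apath A p B" "length p \<le> 2"
        using short[OF AB] by blast
      have "graph_dist \<Gamma> A B \<le> enat (length p)"
        using p(1) by (rule graph_dist_le)
      also have "\<dots> \<le> 2"
        using p(2) by (simp add: numeral_eq_enat)
      finally show ?thesis .
    qed
    then show "graph_diam \<Gamma> \<le> 2"
      by (simp add: graph_diam_def SUP_le_iff)
  next
    have "0\<^sub>m n n $$ (0, 0) \<noteq> (1\<^sub>m n :: 'a mat) $$ (0, 0)"
      using assms(1) by simp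
    then have "0\<^sub>m n n \<noteq> (1\<^sub>m n :: 'a mat)"
      by metis
    then have "2 \<le> graph_dist \<Gamma> (0\<^sub>m n n) (1\<^sub>m n)"
      using zero_one_not_adjacent by (intro two_le_graph_dist) (auto simp: assms(2))
    also have "\<dots> \<le> graph_diam \<Gamma>"
      unfolding graph_diam_def verts
      by (rule SUP_upper2[OF zero_carrier_mat], rule SUP_upper, rule one_carrier_mat)
    finally show "2 \<le> graph_diam \<Gamma>" .
  qed
qed

end
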